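(* Let $f$ be an analytic map on $\mathbb{A}$. Then the following assertions are equivalent: (1) The function $f$ is unimodular on $\mathbb{T}$, i.e. $|f(\xi)| = 1$ for all $\xi \in \mathbb{T}$. (2) There exist $s \in (1,R]$, $n \in \mathbb{Z}$ and an outer function $g_0^s$ in $H^\infty$ which extends analytically to $s\mathbb{D}$ such that $$f(z) = z^n \frac{g_0^s(z)}{\overline{g_0^s(1/\overline{z})}} \quad \text{for all } z \in \mathbb{A}_s := \{z \in \mathbb{C} : 1/s < |z| < s\}.$$
   Context: Fix a real number $R > 1$ and let $\mathbb{A} = \{z \in \mathbb{C} : 1/R < |z| < R\}$. $\mathbb{T}$ is the unit circle, $\mathbb{D}$ the open unit disc, $s\mathbb{D} = \{z : |z| < s\}$, and $H^\infty$ is the space of bounded holomorphic functions on $\mathbb{D}$; "outer" is in the usual sense of Hardy space theory on $\mathbb{D}$. In (2), $g_0^s$ also denotes its analytic extension to $s\mathbb{D}$. *)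

theory Defs
  imports "HOL-Complex_Analysis.Complex_Analysis"
begin

definition sym_annulus :: "real \<Rightarrow> complex set" where
  "sym_annulus r = {z. 1 / r < norm z \<and> norm z < r}"

text \<open>
  Functions on the disc are total functions of type \<open>complex \<Rightarrow> complex\<close>; the predicates
  \<open>H_infinity\<close> and \<open>outer_function\<close> only constrain their values on \<open>ball 0 1\<close>.
\<close>

definition H_infinity :: "(complex \<Rightarrow> complex) set" where
  "H_infinity = {g. g holomorphic_on ball 0 1 \<and> bounded (g ` ball 0 1)}"

text \<open>
  The classical definition: a unimodular constant times the exponential of the Herglotz
  integral of a real-valued \<open>L\<^sup>1\<close> function \<open>k\<close> on the unit circle, the circle being
  parametrised by \<open>t \<mapsto> cis t\<close> on \<open>[-pi, pi]\<close>. The function \<open>k\<close> is then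
  a.e. the logarithm of the modulus of the radial boundary values.
\<close>

definition outer_function :: "(complex \<Rightarrow> complex) \<Rightarrow> bool" where
  "outer_function g \<longleftrightarrow>
     (\<exists>(c::complex) (k::real \<Rightarrow> real).
        norm c = 1 \<and> set_integrable lebesgue {-pi..pi} k \<and>
        (\<forall>z\<in>ball 0 1.
           g z = c * exp (1 / (2 * of_real pi) *
             (LINT t:{-pi..pi}|lebesgue. (cis t + z) / (cis t - z) * of_real (k t)))))"

end

theory Submission
  imports Defs
begin

text \<open>
  If \<open>f\<close> is unimodular on the circle, it has no zeros on a smaller annulus, where
  \<open>f z = z\<^sup>n exp (h z)\<close> with \<open>n\<close> the winding number. As \<open>h\<close> is purely imaginary on the circle, the
  identity theorem gives \<open>h (1 / cnj z) = - cnj (h z)\<close>. By this symmetry the two parts of the Laurent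
  splitting of \<open>h\<close> (Cauchy's formula for the annulus) are reflections of each other, that is,
  \<open>h z = u z - cnj (u (1 / cnj z))\<close> with \<open>u\<close> holomorphic on a disc of radius larger than 1. Then
  \<open>g = exp u\<close> works, and it is outer by the Schwarz integral formula for \<open>u\<close>. Conversely, the
  quotient is unimodular at all points of the circle where \<open>g \<noteq> 0\<close>, and these are dense.
\<close>

section \<open>Integral formulas on the unit circle, and outer functions\<close>

text \<open>With dw = i w dt written out, complex conjugation can be pulled through the integral as
  a real-linear map. It cannot be pulled through a contour integral, where it would conjugate dw as
  well.\<close>

lemma has_contour_integral_circlepath_iff:
  "(f has_contour_integral I) (circlepath 0 r) \<longleftrightarrow>
   ((\<lambda>t. \<i> * (f (of_real r * cis t) * (of_real r * cis t))) has_integral I) {0..2 * pi}"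
  by (simp add: circlepath_def has_contour_integral_part_circlepath_iff mult_ac)

lemma Cauchy_integral_circle_polar:
  assumes "F holomorphic_on cball 0 1" "norm z < 1"
  shows "((\<lambda>t. F (cis t) * cis t / (cis t - z)) has_integral 2 * of_real pi * F z) {0..2 * pi}"
proof -
  have "((\<lambda>w. F w / (w - z)) has_contour_integral (2 * of_real pi * \<i> * F z)) (circlepath 0 1)"
    using assms by (intro Cauchy_integral_circlepath_simple) auto
  then have "((\<lambda>t. - \<i> * (\<i> * (F (cis t) / (cis t - z) * cis t)))
      has_integral - \<i> * (2 * of_real pi * \<i> * F z)) {0..2 * pi}"
    unfolding has_contour_integral_circlepath_iff
    by (intro has_integral_mult_right) simp
  then show ?thesis
    by (simp add: mult_ac)
qed

lemma mean_value_circle_polar: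
  assumes "F holomorphic_on cball 0 1"
  shows "((\<lambda>t. F (cis t)) has_integral 2 * of_real pi * F 0) {0..2 * pi}"
  using Cauchy_integral_circle_polar[OF assms, of 0] by simp

lemma Schwarz_integral_formula:
  assumes u: "u holomorphic_on cball 0 1" and z: "norm z < 1"
  shows "((\<lambda>t. (cis t + z) / (cis t - z) * of_real (Re (u (cis t))))
           has_integral 2 * of_real pi * (u z - \<i> * of_real (Im (u 0)))) {0..2 * pi}"
proof -
  \<comment> \<open>On the circle the Herglotz kernel is conjugate to the factor of \<open>u\<close> in \<open>F\<close>, which is holomorphic
    in \<open>w\<close>: the conjugate half of \<open>Re u\<close> contributes only the constant \<open>cnj (u 0)\<close>.\<close>
  define F where "F = (\<lambda>w. (1 + w * cnj z) / (1 - w * cnj z) * u w)"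
  have nz: "1 - w * cnj z \<noteq> 0" if "norm w \<le> 1" for w
  proof
    assume "1 - w * cnj z = 0"
    then have "norm w * norm z = 1"
      by (metis complex_mod_cnj norm_mult norm_one right_minus_eq)
    moreover have "norm w * norm z \<le> norm z"
      using that by (simp add: mult_left_le_one_le)
    ultimately show False
      using z by simp
  qed
  have "F holomorphic_on cball 0 1"
    unfolding F_def using nz by (intro holomorphic_intros u) auto
  then have "((\<lambda>t. F (cis t)) has_integral 2 * of_real pi * F 0) {0..2 * pi}"
    by (rule mean_value_circle_polar)
  from has_integral_linear[OF this bounded_linear_cnj]
  have C: "((\<lambda>t. cnj (F (cis t))) has_integral 2 * of_real pi * cnj (u 0)) {0..2 * pi}"
    by (simp add: o_def F_def)
  \<comment> \<open>The Herglotz kernel is 2 w / (w - z) - 1, so its integral against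
    \<open>u\<close> is twice the Cauchy formula minus the mean value. The conjugate of
    \<open>F\<close> supplies the other half of Re u = (u + cnj u) / 2.\<close>
  have "((\<lambda>t. 1 / 2 * (2 * (u (cis t) * cis t / (cis t - z)) - u (cis t) + cnj (F (cis t))))
      has_integral 1 / 2 * (2 * (2 * of_real pi * u z) - 2 * of_real pi * u 0
        + 2 * of_real pi * cnj (u 0))) {0..2 * pi}"
    by (intro has_integral_mult_right has_integral_add has_integral_diff C
        Cauchy_integral_circle_polar[OF u z] mean_value_circle_polar[OF u])
  also have "1 / 2 * (2 * (2 * of_real pi * u z) - 2 * of_real pi * u 0 + 2 * of_real pi * cnj (u 0))
      = 2 * of_real pi * (u z - \<i> * of_real (Im (u 0)))"
    by (simp add: complex_eq_iff algebra_simps)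
  also have "(\<lambda>t. 1 / 2 * (2 * (u (cis t) * cis t / (cis t - z)) - u (cis t) + cnj (F (cis t))))
      = (\<lambda>t. (cis t + z) / (cis t - z) * of_real (Re (u (cis t))))"
  proof
    fix t
    have ne: "cis t - z \<noteq> 0"
      using z by (metis norm_cis less_irrefl right_minus_eq)
    have "cnj (F (cis t)) = (1 + z / cis t) / (1 - z / cis t) * cnj (u (cis t))"
      by (simp add: F_def cis_cnj divide_inverse mult.commute flip: cis_inverse)
    also have "(1 + z / cis t) / (1 - z / cis t) = (cis t + z) / (cis t - z)"
      using ne by (simp add: divide_simps)
    finally have "cnj (F (cis t)) = (cis t + z) / (cis t - z) * cnj (u (cis t))" .
    moreover have "2 * (u (cis t) * cis t / (cis t - z)) - u (cis t)
        = (cis t + z) / (cis t - z) * u (cis t)"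
      using ne by (simp add: field_simps)
    moreover have "of_real (Re (u (cis t))) = 1 / 2 * (u (cis t) + cnj (u (cis t)))"
      by (simp add: complex_add_cnj)
    ultimately show "1 / 2 * (2 * (u (cis t) * cis t / (cis t - z)) - u (cis t) + cnj (F (cis t)))
      = (cis t + z) / (cis t - z) * of_real (Re (u (cis t)))"
      by (simp only: distrib_left mult.left_commute[of "1 / 2"])
  qed
  finally show ?thesis .
qed

text \<open>Contour integrals over circles come parametrised on [0, 2 pi], whereas
  \<open>outer_function\<close> integrates over [-pi, pi]. The piece over [pi, 2 pi] is translated
  by one period.\<close>

lemma has_integral_periodic_shift:
  fixes F :: "real \<Rightarrow> 'a::banach"
  assumes per: "\<And>t. F (t + 2 * pi) = F t" and F: "(F has_integral I) {0..2 * pi}"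
  shows "(F has_integral I) {- pi..pi}"
proof -
  have int: "F integrable_on {0..pi}" "F integrable_on {pi..2 * pi}"
    using has_integral_integrable[OF F] by (auto intro: integrable_on_subinterval)
  have "((F \<circ> (+) (2 * pi)) has_integral integral {pi..2 * pi} F) {- pi..0}"
    using int(2) by (subst has_integral_shift_Icc_real) (simp add: has_integral_integral)
  then have "(F has_integral integral {pi..2 * pi} F) {- pi..0}"
    by (simp add: o_def add.commute[of "2 * pi"] per)
  from has_integral_combine[OF _ _ this integrable_integral[OF int(1)]]
  have "(F has_integral integral {pi..2 * pi} F + integral {0..pi} F) {- pi..pi}"
    by simp
  moreover have "integral {0..pi} F + integral {pi..2 * pi} F = I"
    using F by (subst Henstock_Kurzweil_Integration.integral_combine) (auto simp: has_integral_iff)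
  ultimately show ?thesis
    by (simp add: add.commute)
qed

text \<open>By the Schwarz formula, \<open>u\<close> is the Herglotz integral of its real part on
  the circle, up to the imaginary constant i Im (u 0). After exponentiation this constant becomes
  the unimodular factor, and the real part of \<open>u\<close> on the circle is the required
  \<open>k\<close>, integrable because continuous.\<close>

lemma outer_function_exp:
  assumes u: "u holomorphic_on cball 0 1"
  shows "outer_function (\<lambda>z. exp (u z))"
  unfolding outer_function_def
proof (intro exI conjI ballI)
  let ?k = "\<lambda>t. Re (u (cis t))"
  have cont: "continuous_on UNIV (\<lambda>t. u (cis t))"
    by (rule continuous_on_compose2[OF holomorphic_on_imp_continuous_on[OF u]])
       (auto intro!: continuous_intros)
  show "norm (exp (\<i> * of_real (Im (u 0)))) = 1"
    by simp
  show "set_integrable lebesgue {- pi..pi} ?k"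
    by (intro absolutely_integrable_continuous_real continuous_intros continuous_on_subset[OF cont]) auto
  fix z :: complex assume "z \<in> ball 0 1"
  then have z: "norm z < 1" by simp
  then have ne: "cis t - z \<noteq> 0" for t
    by (metis norm_cis less_irrefl right_minus_eq)
  let ?F = "\<lambda>t. (cis t + z) / (cis t - z) * of_real (?k t)"
  have "(?F has_integral 2 * of_real pi * (u z - \<i> * of_real (Im (u 0)))) {- pi..pi}"
    by (rule has_integral_periodic_shift[OF _ Schwarz_integral_formula[OF u z]])
       (simp add: cis.ctr)
  moreover have "set_integrable lebesgue {- pi..pi} ?F"
    using ne by (intro absolutely_integrable_continuous_real continuous_intros
        continuous_on_subset[OF cont]) auto
  ultimately have "(LINT t:{- pi..pi}|lebesgue. ?F t) = 2 * of_real pi * (u z - \<i> * of_real (Im (u 0)))"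
    by (simp add: set_lebesgue_integral_eq_integral(2) integral_unique)
  then show "exp (u z) = exp (\<i> * of_real (Im (u 0))) *
      exp (1 / (2 * of_real pi) * (LINT t:{- pi..pi}|lebesgue. ?F t))"
    by (simp flip: exp_add)
qed

section \<open>Symmetric annuli and reflection in the unit circle\<close>

lemma open_sym_annulus: "open (sym_annulus r)"
  unfolding sym_annulus_def by (intro open_Collect_conj open_Collect_less continuous_intros)

lemma connected_sym_annulus: "connected (sym_annulus r)"
  using connected_annulus(1)[where a = "0::complex"] by (simp add: sym_annulus_def)

lemma sym_annulus_mono: "1 < r \<Longrightarrow> r \<le> s \<Longrightarrow> sym_annulus r \<subseteq> sym_annulus s"
  using frac_le[of 1 1 r s] by (fastforce simp: sym_annulus_def)

lemma sphere_subset_sym_annulus: "1 < r \<Longrightarrow> sphere 0 1 \<subseteq> sym_annulus r"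
  by (auto simp: sym_annulus_def)

lemma sym_annulus_nonzero: "0 < r \<Longrightarrow> z \<in> sym_annulus r \<Longrightarrow> z \<noteq> 0"
  by (auto simp: sym_annulus_def)

lemma inverse_cnj_in_sym_annulus:
  "0 < r \<Longrightarrow> z \<in> sym_annulus r \<Longrightarrow> 1 / cnj z \<in> sym_annulus r"
  by (auto simp: sym_annulus_def norm_divide divide_simps mult_ac)

lemma inverse_cnj_sphere: "norm z = 1 \<Longrightarrow> 1 / cnj z = z"
  using complex_norm_square[of z] by (cases "z = 0") (auto simp: field_simps)

text \<open>A connected set with more than one point has no isolated points. This feeds the identity
  theorem and makes limits along the circle meaningful.\<close>

lemma islimpt_sphere:
  assumes "norm z = 1"
  shows "(z::complex) islimpt sphere 0 1"
proof (rule connected_imp_perfect)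
  show "connected (sphere (0::complex) 1)"
    by (rule connected_sphere) simp
  show "z \<in> sphere 0 1"
    using assms by simp
  show "sphere (0::complex) 1 \<noteq> {a}" for a
  proof
    assume "sphere (0::complex) 1 = {a}"
    then have "1 = a" "-1 = a" by (metis mem_sphere_0 norm_minus_cancel norm_one singletonD)+
    then show False by simp
  qed
qed

text \<open>Conjugating both argument and value keeps holomorphy, so both sides become comparable by
  the identity theorem after one more conjugation. On the circle the reflection is the identity, and
  a purely imaginary number is minus its conjugate.\<close>

lemma imaginary_on_circle_reflection:
  assumes h: "h holomorphic_on sym_annulus s" and s: "1 < s"
    and im: "\<And>z. norm z = 1 \<Longrightarrow> Re (h z) = 0"
    and z: "z \<in> sym_annulus s"
  shows "h (1 / cnj z) = - cnj (h z)"
proof -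
  let ?A = "sym_annulus s"
  have cnjA: "cnj ` ?A = ?A"
    unfolding image_cnj_conv_vimage_cnj by (auto simp: sym_annulus_def)
  have "(\<lambda>w. h (1 / w)) holomorphic_on ?A"
  proof (rule holomorphic_on_compose_gen[unfolded o_def, OF _ h])
    show "(\<lambda>w. 1 / w) holomorphic_on ?A"
      using s sym_annulus_nonzero[of s] by (intro holomorphic_intros) auto
    show "(\<lambda>w. 1 / w) ` ?A \<subseteq> ?A"
      using s by (auto simp: sym_annulus_def norm_divide divide_simps mult_ac)
  qed
  then have "cnj \<circ> (\<lambda>w. h (1 / w)) \<circ> cnj holomorphic_on ?A"
    by (intro holomorphic_on_compose_cnj_cnj open_sym_annulus) (simp add: cnjA)
  then have hol: "(\<lambda>w. cnj (h (1 / cnj w)) + h w) holomorphic_on ?A"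
    by (intro holomorphic_intros h) (simp add: o_def)
  have "cnj (h (1 / cnj z)) + h z = 0"
  proof (rule analytic_continuation[OF hol open_sym_annulus connected_sym_annulus
        sphere_subset_sym_annulus[OF s] _ _ _ z])
    show "1 \<in> ?A"
      using sphere_subset_sym_annulus[OF s] by auto
    show "1 islimpt sphere (0::complex) 1"
      by (rule islimpt_sphere) simp
    show "cnj (h (1 / cnj w)) + h w = 0" if "w \<in> sphere 0 1" for w
      using that im[of w] by (simp add: inverse_cnj_sphere complex_eq_iff)
  qed
  then show ?thesis
    by (metis add_eq_0_iff2 complex_cnj_cnj complex_cnj_minus)
qed

section \<open>Cauchy's formula and the Laurent splitting on an annulus\<close>

text \<open>The two circles are joined by the radial linear homotopy: at each parameter both points
  have the same argument, so the segment between them has moduli between 1 / r and r.\<close>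

lemma contour_integral_circlepath_sym_annulus:
  assumes G: "G holomorphic_on sym_annulus s" and r: "1 < r" "r < s"
  shows "contour_integral (circlepath 0 r) G = contour_integral (circlepath 0 (1 / r)) G"
proof (rule Cauchy_theorem_homotopic_loops[OF _ open_sym_annulus G])
  show "homotopic_loops (sym_annulus s) (circlepath 0 r) (circlepath 0 (1 / r))"
  proof (rule homotopic_loops_linear)
    fix t :: real
    have "norm z \<in> {1 / r..r}"
      if z: "z \<in> closed_segment (circlepath 0 r t) (circlepath 0 (1 / r) t)" for z
    proof -
      from z obtain a where a: "0 \<le> a" "a \<le> 1"
        and "z = of_real ((1 - a) * r + a * (1 / r)) * exp (2 * of_real pi * \<i> * of_real t)"
        by (auto simp: closed_segment_def circlepath scaleR_conv_of_real algebra_simps)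
      then have nz: "norm z = (1 - a) * r + a * (1 / r)"
        using r by (simp add: norm_mult del: of_real_add of_real_mult of_real_diff of_real_divide)
      have "1 / r \<le> r"
        using r by (smt (verit) divide_le_eq_1)
      then show ?thesis
        using a convex_bound_le[of r r "1 / r" "1 - a" a]
          mult_left_mono[of "1 / r" r "1 - a"]
        unfolding nz by (auto simp: left_diff_distrib diff_divide_distrib)
    qed
    moreover have "1 / s < 1 / r"
      using r by (intro divide_strict_left_mono) auto
    ultimately show "closed_segment (circlepath 0 r t) (circlepath 0 (1 / r) t) \<subseteq> sym_annulus s"
      using r by (fastforce simp: sym_annulus_def)
  qed auto
qed auto

text \<open>The difference quotient \<open>?G\<close> extends holomorphically across
  \<open>z\<close>, so its integrals over the two circles agree. What remains is \<open>h z\<close>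
  times the integral of 1 / (w - z), which is 2 pi i over the outer circle and 0 over the inner one,
  since \<open>z\<close> lies between them.\<close>

lemma Cauchy_integral_sym_annulus:
  assumes h: "h holomorphic_on sym_annulus s" and r: "1 < r" "r < s"
    and z: "z \<in> sym_annulus r"
  shows "2 * of_real pi * \<i> * h z = contour_integral (circlepath 0 r) (\<lambda>w. h w / (w - z))
     - contour_integral (circlepath 0 (1 / r)) (\<lambda>w. h w / (w - z))"
proof -
  let ?G = "\<lambda>w. if w = z then deriv h z else (h w - h z) / (w - z)"
  have split: "contour_integral (circlepath 0 \<rho>) ?G
      = contour_integral (circlepath 0 \<rho>) (\<lambda>w. h w / (w - z))
        - h z * contour_integral (circlepath 0 \<rho>) (\<lambda>w. 1 / (w - z))"
    if \<rho>: "\<rho> = r \<or> \<rho> = 1 / r" for \<rho>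
  proof -
    have "1 / s < 1 / r" "1 / r < s"
      using r by (simp_all add: frac_less2) (smt (verit) divide_less_eq_1)
    then have sub: "sphere 0 \<rho> \<subseteq> sym_annulus s" and pos: "0 < \<rho>" and nin: "z \<notin> sphere 0 \<rho>"
      using r z \<rho> by (auto simp: sym_annulus_def)
    have cont: "continuous_on (path_image (circlepath 0 \<rho>)) (\<lambda>w. h w / (w - z))"
      "continuous_on (path_image (circlepath 0 \<rho>)) (\<lambda>w. 1 / (w - z))"
      using nin pos holomorphic_on_imp_continuous_on[OF holomorphic_on_subset[OF h sub]]
      by (auto intro!: continuous_intros)
    have "contour_integral (circlepath 0 \<rho>) ?G
        = contour_integral (circlepath 0 \<rho>) (\<lambda>w. h w / (w - z) - h z * (1 / (w - z)))"
      using nin pos by (intro contour_integral_cong) (auto simp: diff_divide_distrib)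
    also have "\<dots> = contour_integral (circlepath 0 \<rho>) (\<lambda>w. h w / (w - z))
        - h z * contour_integral (circlepath 0 \<rho>) (\<lambda>w. 1 / (w - z))"
      using cont by (subst contour_integral_diff)
        (simp_all only: contour_integral_lmul contour_integrable_lmul
          contour_integrable_continuous_circlepath)
    finally show ?thesis .
  qed
  have "contour_integral (circlepath 0 r) (\<lambda>w. 1 / (w - z)) = 2 * of_real pi * \<i>"
    using z Cauchy_integral_circlepath_simple[of "\<lambda>_. 1" 0 r z]
    by (auto simp: sym_annulus_def intro: contour_integral_unique)
  moreover have "((\<lambda>w. 1 / (w - z)) has_contour_integral 0) (circlepath 0 (1 / r))"
    using z r by (intro Cauchy_theorem_disc_simple[where a = 0 and e = "norm z"] holomorphic_intros)
      (auto simp: sym_annulus_def)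
  then have "contour_integral (circlepath 0 (1 / r)) (\<lambda>w. 1 / (w - z)) = 0"
    by (rule contour_integral_unique)
  moreover have "contour_integral (circlepath 0 r) ?G = contour_integral (circlepath 0 (1 / r)) ?G"
    by (rule contour_integral_circlepath_sym_annulus[OF _ r])
       (rule pole_lemma_open[OF h open_sym_annulus])
  ultimately show ?thesis
    by (simp add: split algebra_simps)
qed

lemma sym_annulus_decomposition:
  assumes h: "h holomorphic_on sym_annulus s" and r: "1 < r" "r < s"
    and sym: "\<And>z. z \<in> sym_annulus s \<Longrightarrow> h (1 / cnj z) = - cnj (h z)"
  obtains u where "u holomorphic_on ball 0 r"
    and "\<And>z. z \<in> sym_annulus r \<Longrightarrow> h z = u z - cnj (u (1 / cnj z))"
proof -
  define P where "P = (\<lambda>z. contour_integral (circlepath 0 r) (\<lambda>w. h w / (w - z)) / (2 * of_real pi * \<i>))"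
  \<comment> \<open>This is \<open>P 0\<close>, the constant Laurent coefficient of
    \<open>h\<close>.\<close>
  define c where "c = contour_integral (circlepath 0 r) (\<lambda>w. h w / w) / (2 * of_real pi * \<i>)"
  have inA: "of_real r * cis t \<in> sym_annulus s" for t
    using r by (auto simp: sym_annulus_def norm_mult) (smt (verit) divide_less_eq_1)
  have "sphere 0 r \<subseteq> sym_annulus s"
    using r by (auto simp: sym_annulus_def) (smt (verit) divide_less_eq_1)
  then have conth: "continuous_on (path_image (circlepath 0 r)) h"
    using r by (auto intro: holomorphic_on_imp_continuous_on holomorphic_on_subset[OF h])
  have int: "((\<lambda>w. h w / (w - z)) has_contour_integral (2 * of_real pi * \<i> * P z)) (circlepath 0 r)"
    if "norm z < r" for z
    unfolding P_def using that r conth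
    by (auto intro!: has_contour_integral_integral contour_integrable_continuous_circlepath continuous_intros)
  have P: "P holomorphic_on ball 0 r"
  proof -
    have "(\<lambda>z. 2 * of_real pi * \<i> * P z) holomorphic_on ball 0 r"
      \<comment> \<open>Differentiation under the integral sign.\<close>
      unfolding holomorphic_on_open[OF open_ball]
      using Cauchy_next_derivative_circlepath(2)[OF conth, of 1] int by fastforce
    then have "(\<lambda>z. 2 * of_real pi * \<i> * P z / (2 * of_real pi * \<i>)) holomorphic_on ball 0 r"
      by (rule holomorphic_on_divide) (auto intro: holomorphic_intros)
    then show ?thesis by (subst (asm) nonzero_mult_div_cancel_left) auto
  qed
  have eq: "h z = P z - cnj (P (1 / cnj z)) + cnj c" if z: "z \<in> sym_annulus r" for z
  proof -
    \<comment> \<open>The symmetry turns the Cauchy integral over the inner circle into the conjugate of one over the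
      outer circle, with \<open>z\<close> replaced by its reflection \<open>\<zeta>\<close>.\<close>
    define \<zeta> where "\<zeta> = 1 / cnj z"
    have z0: "z \<noteq> 0" and \<zeta>: "norm \<zeta> < r"
      using sym_annulus_nonzero[OF _ z] inverse_cnj_in_sym_annulus[OF _ z] r
      by (auto simp: \<zeta>_def sym_annulus_def)
    have z_eq: "z = 1 / cnj \<zeta>" by (simp add: \<zeta>_def)
    \<comment> \<open>Substituting w = 1 / cnj v turns the inner kernel w / (w - z) into the
      conjugate of 1 - v / (v - \<zeta>); hence the difference of the Cauchy kernels at 0 and at
      \<zeta>.\<close>
    have "((\<lambda>w. h w / (w - 0) - h w / (w - \<zeta>)) has_contour_integral
        2 * of_real pi * \<i> * P 0 - 2 * of_real pi * \<i> * P \<zeta>) (circlepath 0 r)"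
      using r \<zeta> by (intro has_contour_integral_diff int) auto
    moreover have "P 0 = c" by (simp add: P_def c_def)
    ultimately have "((\<lambda>w. h w / w - h w / (w - \<zeta>)) has_contour_integral
        2 * of_real pi * \<i> * c - 2 * of_real pi * \<i> * P \<zeta>) (circlepath 0 r)"
      by simp
    from has_integral_linear[OF this[unfolded has_contour_integral_circlepath_iff] bounded_linear_cnj]
    have "((\<lambda>t. cnj (\<i> * ((h (of_real r * cis t) / (of_real r * cis t)
          - h (of_real r * cis t) / (of_real r * cis t - \<zeta>)) * (of_real r * cis t))))
        has_integral cnj (2 * of_real pi * \<i> * c - 2 * of_real pi * \<i> * P \<zeta>)) {0..2 * pi}"
      unfolding o_def .
    also have "(\<lambda>t. cnj (\<i> * ((h (of_real r * cis t) / (of_real r * cis t)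
          - h (of_real r * cis t) / (of_real r * cis t - \<zeta>)) * (of_real r * cis t))))
        = (\<lambda>t. \<i> * (h (of_real (1 / r) * cis t) / (of_real (1 / r) * cis t - z)
            * (of_real (1 / r) * cis t)))"
    proof
      fix t
      define v where "v = of_real r * cis t"
      have v0: "v \<noteq> 0" and nv: "norm v = r"
        using r by (auto simp: v_def norm_mult)
      have w: "of_real (1 / r) * cis t = 1 / cnj v"
        using r by (simp add: v_def cis_cnj field_simps cis_mult)
      have "h (1 / cnj v) = - cnj (h v)"
        by (rule sym) (simp add: v_def inA)
      moreover have "cnj v \<noteq> cnj \<zeta>" using nv \<zeta> by auto
      ultimately show "cnj (\<i> * ((h (of_real r * cis t) / (of_real r * cis t)
          - h (of_real r * cis t) / (of_real r * cis t - \<zeta>)) * (of_real r * cis t)))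
        = \<i> * (h (of_real (1 / r) * cis t) / (of_real (1 / r) * cis t - z)
            * (of_real (1 / r) * cis t))"
        using v0 z0 unfolding v_def[symmetric] w z_eq by (simp add: \<zeta>_def field_simps)
    qed
    finally have "contour_integral (circlepath 0 (1 / r)) (\<lambda>w. h w / (w - z))
        = cnj (2 * of_real pi * \<i> * c - 2 * of_real pi * \<i> * P \<zeta>)"
      by (intro contour_integral_unique) (simp only: has_contour_integral_circlepath_iff)
    with Cauchy_integral_sym_annulus[OF h r z]
    have "2 * of_real pi * \<i> * h z = 2 * of_real pi * \<i> * (P z - cnj (P \<zeta>) + cnj c)"
      by (simp add: P_def algebra_simps)
    then show ?thesis
      by (simp add: \<zeta>_def)
  qed
  have one: "1 \<in> sym_annulus r" "1 \<in> sym_annulus s"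
    using r by (auto simp: sym_annulus_def)
  \<comment> \<open>The point 1 is fixed by the reflection: \<open>sym\<close> makes
    \<open>h 1\<close> imaginary there, and \<open>P 1 - cnj (P 1)\<close> is imaginary
    anyway.\<close>
  have "Re c = 0"
    using eq[OF one(1)] sym[OF one(2)] by (simp add: complex_eq_iff)
  show thesis
  proof
    \<comment> \<open>The constant is shared equally: as \<open>c\<close> is imaginary,
      \<open>cnj c / 2 - cnj (cnj c / 2)\<close> equals \<open>cnj c\<close>.\<close>
    show "(\<lambda>z. P z + cnj c / 2) holomorphic_on ball 0 r"
      by (intro holomorphic_intros P)
    show "h z = P z + cnj c / 2 - cnj (P (1 / cnj z) + cnj c / 2)" if "z \<in> sym_annulus r" for z
      using eq[OF that] \<open>Re c = 0\<close> by (simp add: complex_eq_iff)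
  qed
qed

section \<open>Logarithms on an annulus\<close>

text \<open>The jump of \<open>Ln\<close> across its cut is a period of \<open>K\<close>, so it is
  invisible after composition. Near each \<open>z0\<close> the branch
  \<open>Ln (z / z0) + Ln z0\<close>, whose cut avoids \<open>z0\<close>, can therefore replace
  \<open>Ln\<close>.\<close>

lemma holomorphic_on_periodic_comp_Ln:
  assumes K: "K holomorphic_on {w. Re w \<in> I}" and "open I"
    and per: "\<And>w. Re w \<in> I \<Longrightarrow> K (w + 2 * of_real pi * \<i>) = K w"
    and A: "\<And>z. z \<in> A \<Longrightarrow> z \<noteq> 0 \<and> ln (norm z) \<in> I" and "open A"
  shows "(\<lambda>z. K (Ln z)) holomorphic_on A"
proof -
  have per_nat: "K (w + 2 * of_real pi * \<i> * of_nat n) = K w" if "Re w \<in> I" for w n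
  proof (induction n)
    case (Suc n)
    have "K (w + 2 * of_real pi * \<i> * of_nat (Suc n))
        = K ((w + 2 * of_real pi * \<i> * of_nat n) + 2 * of_real pi * \<i>)"
      by (simp add: algebra_simps)
    also have "\<dots> = K w"
      using that by (subst per) (simp_all add: Suc)
    finally show ?case .
  qed simp
  have per_int: "K w = K w'" if exp: "exp w = exp w'" and w: "Re w \<in> I" for w w'
  proof -
    obtain m :: int where m: "w = w' + (of_int (2 * m) * pi) * \<i>"
      using exp unfolding exp_eq by blast
    show ?thesis
    proof (cases "m \<ge> 0")
      case True
      then have "w = w' + 2 * of_real pi * \<i> * of_nat (nat m)"
        unfolding m by (simp add: of_nat_nat)
      then show ?thesis
        using w per_nat[of w'] by simp
    next
      case False
      then have "w' = w + 2 * of_real pi * \<i> * of_nat (nat (- m))"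
        unfolding m by (simp add: of_nat_nat)
      then show ?thesis
        using w per_nat[of w] by simp
    qed
  qed
  define U where "U = (\<lambda>z0. A \<inter> (\<lambda>z. z / z0) -` (- \<real>\<^sub>\<le>\<^sub>0))"
  have "(\<lambda>z. K (Ln z)) holomorphic_on U z0" if "z0 \<in> A" for z0
  proof -
    have z0: "z0 \<noteq> 0" using A that by blast
    have hol: "(\<lambda>z. Ln (z / z0) + Ln z0) holomorphic_on U z0"
      using z0 by (intro holomorphic_intros) (auto simp: U_def)
    have exp_eq: "exp (Ln (z / z0) + Ln z0) = z" and Re: "Re (Ln (z / z0) + Ln z0) \<in> I"
      if "z \<in> U z0" for z
      using A[of z] that z0 by (auto simp: U_def exp_add norm_divide ln_div)
    have "(\<lambda>z. K (Ln (z / z0) + Ln z0)) holomorphic_on U z0"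
      using Re by (intro holomorphic_on_compose_gen[OF hol K, unfolded o_def]) auto
    also have "?this \<longleftrightarrow> ?thesis"
    proof (rule holomorphic_cong)
      fix z assume "z \<in> U z0"
      then show "K (Ln (z / z0) + Ln z0) = K (Ln z)"
        using exp_eq[of z] Re[of z] A[of z] by (intro per_int) (auto simp: U_def)
    qed simp
    finally show ?thesis .
  qed
  moreover have "open (U z0)" if "z0 \<in> A" for z0
    unfolding U_def using that A \<open>open A\<close>
    by (intro open_Int open_vimage continuous_intros) auto
  moreover have "(\<Union>z0\<in>A. U z0) = A"
    using A by (auto simp: U_def)
  ultimately show ?thesis
    using holomorphic_on_UN_open[of A "\<lambda>z. K (Ln z)" U] by auto
qed
lemma sym_annulus_logarithm:
  assumes f: "f holomorphic_on sym_annulus s" and s: "1 < s"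
    and nz: "\<And>z. z \<in> sym_annulus s \<Longrightarrow> f z \<noteq> 0"
  obtains h and n :: int where "h holomorphic_on sym_annulus s"
    and "\<And>z. z \<in> sym_annulus s \<Longrightarrow> f z = z powi n * exp (h z)"
proof -
  \<comment> \<open>Take a logarithm \<open>H\<close> of \<open>f \<circ> exp\<close> on the strip covering the annulus; it grows by a constant
    \<open>2 \<pi> \<i> n\<close> per period, so \<open>H w - n w\<close> descends to the annulus.\<close>
  define I where "I = {- ln s<..<ln s}"
  let ?S = "{w::complex. Re w \<in> I}"
  have S: "convex ?S" "open ?S"
    by (auto simp: I_def convex_halfspace_Re_lt convex_halfspace_Re_gt open_halfspace_Re_lt
        open_halfspace_Re_gt Collect_conj_eq intro!: convex_Int open_Int)
  have A: "z \<noteq> 0 \<and> ln (norm z) \<in> I" if "z \<in> sym_annulus s" for z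
  proof -
    have "z \<noteq> 0" using sym_annulus_nonzero[of s] that s by simp
    then show ?thesis
      using that s ln_less_cancel_iff[of "1 / s" "norm z"] ln_less_cancel_iff[of "norm z" s]
      by (auto simp: sym_annulus_def I_def ln_div)
  qed
  have expA: "exp w \<in> sym_annulus s" if "w \<in> ?S" for w
  proof -
    have "exp (- ln s) < exp (Re w)" "exp (Re w) < exp (ln s)"
      using that by (simp_all add: I_def)
    then show ?thesis
      using s by (simp add: sym_annulus_def exp_minus divide_inverse)
  qed
  have "(\<lambda>w. f (exp w)) holomorphic_on ?S"
    using expA by (intro holomorphic_on_compose_gen[OF holomorphic_on_exp f, unfolded o_def]) auto
  moreover have "f (exp w) \<noteq> 0" if "w \<in> ?S" for w
    using nz expA[OF that] by blast
  moreover have "0 \<in> ?S"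
    using s by (simp add: I_def)
  ultimately obtain H where H: "H holomorphic_on ?S" and expH: "\<And>w. w \<in> ?S \<Longrightarrow> exp (H w) = f (exp w)"
    using holomorphic_logarithm_exists[OF S, of "\<lambda>w. f (exp w)" 0] by blast
  define D where "D = (\<lambda>w. H (w + 2 * of_real pi * \<i>) - H w)"
  have D_int: "\<exists>m::int. D w = of_int m * (2 * of_real pi * \<i>)" if "w \<in> ?S" for w
  proof -
    have "exp (H (w + 2 * of_real pi * \<i>)) = exp (H w)"
      using that by (simp add: expH exp_add)
    then show ?thesis
      unfolding D_def exp_eq by (auto simp: algebra_simps)
  qed
  \<comment> \<open>\<open>D\<close> is continuous on a connected set, and its values lie in 2 pi i
    Z, where distinct points are at least 2 pi apart.\<close>
  have "D constant_on ?S"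
  proof (rule continuous_discrete_range_constant)
    show "connected ?S"
      by (rule convex_connected[OF S(1)])
    have cont: "continuous_on ?S H"
      by (rule holomorphic_on_imp_continuous_on[OF H])
    have "continuous_on ?S (\<lambda>w. H (w + 2 * of_real pi * \<i>))"
      by (rule continuous_on_compose2[OF cont]) (auto intro!: continuous_intros)
    then show "continuous_on ?S D"
      unfolding D_def by (intro continuous_on_diff cont)
    show "\<exists>e>0. \<forall>y. y \<in> ?S \<and> D y \<noteq> D x \<longrightarrow> e \<le> norm (D y - D x)" if x: "x \<in> ?S" for x
    proof (intro exI[of _ "2 * pi"] conjI allI impI)
      fix y assume y: "y \<in> ?S \<and> D y \<noteq> D x"
      obtain m m' :: int where "D x = of_int m * (2 * of_real pi * \<i>)"
        "D y = of_int m' * (2 * of_real pi * \<i>)"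
        using D_int x y by metis
      moreover from this y have "m \<noteq> m'" by auto
      ultimately have "D y - D x = of_int (m' - m) * (2 * of_real pi * \<i>)" "1 \<le> \<bar>m' - m\<bar>"
        by (simp_all add: left_diff_distrib)
      then have "norm (D y - D x) = real_of_int \<bar>m' - m\<bar> * (2 * pi)" "1 \<le> \<bar>m' - m\<bar>"
        by (simp_all only: norm_mult norm_of_int) simp_all
      then show "2 * pi \<le> norm (D y - D x)"
        using mult_right_mono[of 1 "real_of_int \<bar>m' - m\<bar>" "2 * pi"] by simp
    qed simp
  qed
  then obtain n :: int where n: "\<And>w. w \<in> ?S \<Longrightarrow> D w = of_int n * (2 * of_real pi * \<i>)"
    using D_int \<open>0 \<in> ?S\<close> unfolding constant_on_def by metis
  show thesis
  proof (rule that[of "\<lambda>z. H (Ln z) - of_int n * Ln z" n])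
    show "(\<lambda>z. H (Ln z) - of_int n * Ln z) holomorphic_on sym_annulus s"
    proof (rule holomorphic_on_periodic_comp_Ln[OF _ _ _ A open_sym_annulus])
      show "(\<lambda>w. H w - of_int n * w) holomorphic_on ?S"
        by (intro holomorphic_intros H)
      show "H (w + 2 * of_real pi * \<i>) - of_int n * (w + 2 * of_real pi * \<i>) = H w - of_int n * w"
        if "Re w \<in> I" for w
        using n[of w] that by (simp add: D_def algebra_simps)
    qed (simp_all add: I_def)
    fix z assume z: "z \<in> sym_annulus s"
    then have "Ln z \<in> ?S" "exp (Ln z) = z"
      using A[OF z] by auto
    moreover from this have "exp (of_int n * Ln z) = z powi n"
      using exp_power_int[of "Ln z" n] by (simp add: mult.commute)
    ultimately show "f z = z powi n * exp (H (Ln z) - of_int n * Ln z)"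
      using expH[of "Ln z"] A[OF z] by (simp add: exp_diff)
  qed
qed

section \<open>Zeros near the circle, and the modulus of the quotient\<close>

text \<open>The nonvanishing set is open and contains the compact circle, hence a uniform
  neighbourhood of it, which contains a thin annulus.\<close>

lemma nonzero_sym_annulus:
  assumes f: "f holomorphic_on sym_annulus R" and R: "1 < R"
    and nz: "\<And>z. norm z = 1 \<Longrightarrow> f z \<noteq> 0"
  obtains s where "1 < s" "s \<le> R" "\<And>z. z \<in> sym_annulus s \<Longrightarrow> f z \<noteq> 0"
proof -
  let ?B = "{z \<in> sym_annulus R. f z \<noteq> 0}"
  have "open ?B"
    using continuous_open_preimage[OF holomorphic_on_imp_continuous_on[OF f] open_sym_annulus, of "- {0}"]
    by (simp add: vimage_def Int_def open_Compl)
  moreover have "sphere 0 1 \<subseteq> ?B"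
    using sphere_subset_sym_annulus[OF R] nz by auto
  ultimately obtain e where e: "e > 0" "(\<Union>x\<in>sphere 0 1. ball x e) \<subseteq> ?B"
    using compact_subset_open_imp_ball_epsilon_subset[OF compact_sphere] by metis
  show thesis
  proof (rule that[of "min R (1 + e)"])
    fix z assume z: "z \<in> sym_annulus (min R (1 + e))"
    define s where "s = min R (1 + e)"
    have s: "1 < s" "s \<le> 1 + e" using R e by (auto simp: s_def)
    have nz: "1 / s < norm z" "norm z < s"
      using z by (auto simp: sym_annulus_def s_def)
    \<comment> \<open>Equivalent to (s - 1)^2 >= 0; it shows that the inner radius is no farther
      from 1 than the outer one. The distance to the circle is then measured at the radial
      projection \<open>sgn z\<close>.\<close>
    have "2 - s \<le> 1 / s"
      using s sum_squares_ge_zero[of "s - 1" 0] by (simp add: field_simps)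
    then have "\<bar>norm z - 1\<bar> < e"
      using s nz by linarith
    moreover have "z \<noteq> 0" using nz s by auto
    then have "z - sgn z = of_real (norm z - 1) * sgn z" and "norm (sgn z) = 1"
      by (simp_all add: sgn_eq field_simps norm_divide)
    then have "dist z (sgn z) = \<bar>norm z - 1\<bar>" and "norm (sgn z) = 1"
      by (simp_all only: dist_norm norm_mult norm_of_real mult_1_right)
    ultimately have "z \<in> ball (sgn z) e"
      by (simp add: dist_commute)
    then show "f z \<noteq> 0"
      using e(2) \<open>norm (sgn z) = 1\<close> by fastforce
  qed (use R e in auto)
qed

lemma norm_quotient_on_circle:
  fixes g :: "complex \<Rightarrow> complex"
  assumes "norm z = 1" "g z \<noteq> 0"
  shows "norm (z powi n * (g z / cnj (g (1 / cnj z)))) = 1"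
  using assms by (simp add: inverse_cnj_sphere norm_mult norm_divide norm_power_int)

lemma unimodular_of_quotient:
  assumes f: "f holomorphic_on sym_annulus s" and s: "1 < s"
    and g: "g holomorphic_on ball 0 s" "g 0 \<noteq> 0"
    and eq: "\<And>z. z \<in> sym_annulus s \<Longrightarrow> f z = z powi n * (g z / cnj (g (1 / cnj z)))"
    and \<xi>: "norm \<xi> = 1"
  shows "norm (f \<xi>) = 1"
proof -
  \<comment> \<open>At a zero of \<open>g\<close> on the circle the quotient has the junk value \<open>0\<close>; such zeros are isolated,
    so they are excluded by the continuity of \<open>f\<close>.\<close>
  have "\<forall>\<^sub>F z in at \<xi>. g z \<noteq> 0"
  proof (cases "g \<xi> = 0")
    case True
    \<comment> \<open>Since \<open>g 0\<close> is nonzero, \<open>g\<close> is not identically zero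
      on the disc, so the zero at \<xi> is isolated.\<close>
    then obtain r where "0 < r" "\<And>z. z \<in> ball \<xi> r - {\<xi>} \<Longrightarrow> g z \<noteq> 0"
      using isolated_zeros[OF g(1) open_ball connected_ball, of \<xi> 0] g(2) \<xi> s
      by (metis (no_types, lifting) mem_ball_0 norm_zero less_trans zero_less_one)
    then show ?thesis
      unfolding eventually_at by (auto simp: dist_commute)
  next
    case False
    have "isCont g \<xi>"
      using holomorphic_on_imp_continuous_on[OF g(1)] \<xi> s
      by (simp add: continuous_on_eq_continuous_at)
    then show ?thesis
      using tendsto_imp_eventually_ne[OF _ False] by (simp add: isCont_def)
  qed
  then have "\<forall>\<^sub>F z in at \<xi> within sphere 0 1. g z \<noteq> 0"
    by (rule filter_leD[OF at_le[OF subset_UNIV]])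
  moreover have "\<forall>\<^sub>F z in at \<xi> within sphere 0 1. norm z = 1"
    by (simp add: eventually_at_filter)
  ultimately have "\<forall>\<^sub>F z in at \<xi> within sphere 0 1. norm (f z) = 1"
  proof eventually_elim
    case (elim z)
    then have "z \<in> sym_annulus s"
      using sphere_subset_sym_annulus[OF s] by auto
    then show ?case
      using elim norm_quotient_on_circle by (simp add: eq)
  qed
  then have "((\<lambda>z. norm (f z)) \<longlongrightarrow> 1) (at \<xi> within sphere 0 1)"
    by (rule tendsto_eventually)
  moreover have "((\<lambda>z. norm (f z)) \<longlongrightarrow> norm (f \<xi>)) (at \<xi> within sphere 0 1)"
    using continuous_on_subset[OF holomorphic_on_imp_continuous_on[OF f] sphere_subset_sym_annulus[OF s]] \<xi>
    by (intro tendsto_norm) (simp add: continuous_on)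
  moreover have "at \<xi> within sphere 0 1 \<noteq> bot"
    using islimpt_sphere[OF \<xi>] by (simp add: trivial_limit_within)
  ultimately show ?thesis
    using tendsto_unique by blast
qed

section \<open>Both directions of the equivalence assembled\<close>

theorem theorem5p4:
  fixes R :: real and f :: "complex \<Rightarrow> complex"
  assumes "R > 1"
    and "f holomorphic_on sym_annulus R"
  shows "(\<forall>\<xi>\<in>sphere 0 1. norm (f \<xi>) = 1) \<longleftrightarrow>
    (\<exists>s\<in>{1<..R}. \<exists>n::int. \<exists>g\<in>H_infinity.
        outer_function g \<and> g holomorphic_on ball 0 s \<and>
        (\<forall>z\<in>sym_annulus s. f z = z powi n * (g z / cnj (g (1 / cnj z)))))"
proof (intro iffI)
  assume uni: "\<forall>\<xi>\<in>sphere 0 1. norm (f \<xi>) = 1"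
  have "f z \<noteq> 0" if "norm z = 1" for z
    using uni that by force
  then obtain s where s: "1 < s" "s \<le> R" and nz: "\<And>z. z \<in> sym_annulus s \<Longrightarrow> f z \<noteq> 0"
    using nonzero_sym_annulus[OF assms(2,1)] by metis
  have "f holomorphic_on sym_annulus s"
    using assms(2) sym_annulus_mono[OF s] by (rule holomorphic_on_subset)
  then obtain h and n :: int where h: "h holomorphic_on sym_annulus s"
    and f_eq: "\<And>z. z \<in> sym_annulus s \<Longrightarrow> f z = z powi n * exp (h z)"
    using sym_annulus_logarithm s(1) nz by metis
  \<comment> \<open>Taking moduli in f = z^n exp h on the circle leaves exp (Re h) = 1.\<close>
  have "Re (h z) = 0" if "norm z = 1" for z
  proof -
    have "z \<in> sym_annulus s"
      using sphere_subset_sym_annulus[OF s(1)] that by auto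
    moreover have "norm (f z) = 1"
      using uni that by simp
    ultimately show ?thesis
      using f_eq[of z] that by (simp add: norm_mult norm_power_int)
  qed
  then have sym: "h (1 / cnj z) = - cnj (h z)" if "z \<in> sym_annulus s" for z
    using imaginary_on_circle_reflection[OF h s(1) _ that] by blast
  \<comment> \<open>The splitting integrates over the circle of radius \<open>r\<close>, which must
    lie inside the domain of \<open>h\<close>. This \<open>r\<close> becomes the radius claimed in
    the theorem.\<close>
  obtain r where r: "1 < r" "r < s"
    using dense[OF s(1)] by blast
  obtain u where u: "u holomorphic_on ball 0 r"
    and h_eq: "\<And>z. z \<in> sym_annulus r \<Longrightarrow> h z = u z - cnj (u (1 / cnj z))"
    using sym_annulus_decomposition[OF h r sym] by metis
  define g where "g = (\<lambda>z. exp (u z))"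
  have u1: "u holomorphic_on cball 0 1"
    using u r by (rule_tac holomorphic_on_subset) auto
  have g: "g holomorphic_on ball 0 r"
    unfolding g_def by (intro holomorphic_intros u)
  have "compact (g ` cball 0 1)"
    unfolding g_def
    by (intro compact_continuous_image continuous_intros holomorphic_on_imp_continuous_on u1) simp
  then have "bounded (g ` ball 0 1)"
    by (rule bounded_subset[OF compact_imp_bounded]) auto
  then have "g \<in> H_infinity"
    using g r by (auto simp: H_infinity_def intro: holomorphic_on_subset)
  moreover have "f z = z powi n * (g z / cnj (g (1 / cnj z)))" if "z \<in> sym_annulus r" for z
    using f_eq[of z] h_eq[OF that] that sym_annulus_mono[of r s] r
    by (auto simp: g_def exp_diff exp_cnj)
  moreover have "outer_function g"
    unfolding g_def by (rule outer_function_exp[OF u1])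
  ultimately show "\<exists>s\<in>{1<..R}. \<exists>n::int. \<exists>g\<in>H_infinity.
      outer_function g \<and> g holomorphic_on ball 0 s \<and>
      (\<forall>z\<in>sym_annulus s. f z = z powi n * (g z / cnj (g (1 / cnj z))))"
    using g r s by (intro bexI[of _ r] exI[of _ n] bexI[of _ g]) auto
next
  assume "\<exists>s\<in>{1<..R}. \<exists>n::int. \<exists>g\<in>H_infinity.
      outer_function g \<and> g holomorphic_on ball 0 s \<and>
      (\<forall>z\<in>sym_annulus s. f z = z powi n * (g z / cnj (g (1 / cnj z))))"
  then obtain s n g where "s \<in> {1<..R}" and "outer_function g" and g: "g holomorphic_on ball 0 s"
    and eq: "\<And>z. z \<in> sym_annulus s \<Longrightarrow> f z = z powi n * (g z / cnj (g (1 / cnj z)))"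
    by metis
  then have s: "1 < s" "s \<le> R" by auto
  \<comment> \<open>An outer function is a unimodular constant times an exponential, so it has no
    zeros in the open disc.\<close>
  have "g 0 \<noteq> 0"
    using \<open>outer_function g\<close> by (auto simp: outer_function_def)
  moreover have "f holomorphic_on sym_annulus s"
    using assms(2) sym_annulus_mono[OF s] by (rule holomorphic_on_subset)
  ultimately show "\<forall>\<xi>\<in>sphere 0 1. norm (f \<xi>) = 1"
    using unimodular_of_quotient[OF _ s(1) g _ eq] by simp
qed

end
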